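(* Suppose the Laplacian $L(G)$ of a weighted graph $G$ is diagonalisable by a dephased complex Hadamard matrix $H$ of order $n$, say $L(G)=\frac1n H\Lambda H^*$, where $\Lambda$ is the diagonal matrix with $\Lambda_{j,j}=\lambda_j$ for $j=1,\dots,n$. Then $(\alpha,\beta)$-(Laplacian) fractional revival occurs from vertex $a$ to vertex $b$ in $G$ at time $\tau$ if and only if, for $j=1,\dots,n$, (1) $H_{a,j}=\pm H_{b,j}$, and (2) $e^{-\mathrm i\tau\lambda_j}=\begin{cases}1&\text{if }H_{a,j}=H_{b,j},\\ \alpha-\beta&\text{if }H_{a,j}=-H_{b,j}.\end{cases}$ In this case, there exists a real number $\gamma$ such that $$\alpha=\cos\gamma\, e^{\mathrm i\gamma},\qquad \beta=-\mathrm i\sin\gamma\, e^{\mathrm i\gamma},\qquad \alpha-\beta=e^{2\gamma\mathrm i}.$$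
   Context: Graphs are simple and weighted with non-negative real edge weights; $A(G)$ is the matrix of edge weights and $L(G)=D(G)-A(G)$, with $D(G)$ the diagonal matrix of row sums of $A(G)$. A complex Hadamard matrix of order $n$ is an $n\times n$ complex matrix $H$ whose entries all have modulus one and which satisfies $HH^*=nI$; it is dephased if its first row and first column are all-ones vectors. Rows of $H$ are indexed by the vertices of $G$. $\mathbf e_v$ is the characteristic (standard basis) vector of vertex $v$. For complex scalars $\alpha$ and $\beta\ne0$ with $|\alpha|^2+|\beta|^2=1$, $(\alpha,\beta)$-(Laplacian) fractional revival occurs from vertex $a$ to vertex $b$ in $G$ at time $\tau$ if $e^{-\mathrm i\tau L(G)}\mathbf e_a=\alpha\mathbf e_a+\beta\mathbf e_b$.
   Formalization: The condition α+β=1 is added to (1) and (2) in the equivalence: without it the "if" direction fails (e.g. K_2, τ=π/2, α=(i−1)/2, β=(i+1)/2). It is proved as a consequence of fractional revival in the "only if" direction. *)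

theory Defs
  imports Complex_Main "Jordan_Normal_Form.Schur_Decomposition"
begin

text \<open>Graphs of order \<open>n\<close> have vertex set \<open>{0..<n}\<close> and are given by their edge weights,
  \<open>w i j = 0\<close> meaning that there is no edge. All matrix indices start at 0.\<close>

definition weighted_graph :: "nat \<Rightarrow> (nat \<Rightarrow> nat \<Rightarrow> real) \<Rightarrow> bool" where
  "weighted_graph n w \<longleftrightarrow>
     (\<forall>i<n. w i i = 0) \<and> (\<forall>i<n. \<forall>j<n. w i j = w j i) \<and> (\<forall>i<n. \<forall>j<n. w i j \<ge> 0)"

definition adjacency_mat :: "nat \<Rightarrow> (nat \<Rightarrow> nat \<Rightarrow> real) \<Rightarrow> complex mat" where
  "adjacency_mat n w = mat n n (\<lambda>(i, j). complex_of_real (w i j))"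

definition degree_mat :: "nat \<Rightarrow> (nat \<Rightarrow> nat \<Rightarrow> real) \<Rightarrow> complex mat" where
  "degree_mat n w = mat_diag n (\<lambda>i. \<Sum>j<n. adjacency_mat n w $$ (i, j))"

definition laplacian_mat :: "nat \<Rightarrow> (nat \<Rightarrow> nat \<Rightarrow> real) \<Rightarrow> complex mat" where
  "laplacian_mat n w = degree_mat n w - adjacency_mat n w"

definition complex_hadamard :: "nat \<Rightarrow> complex mat \<Rightarrow> bool" where
  "complex_hadamard n H \<longleftrightarrow> H \<in> carrier_mat n n \<and> (\<forall>i<n. \<forall>j<n. norm (H $$ (i, j)) = 1) \<and>
     H * mat_adjoint H = of_nat n \<cdot>\<^sub>m 1\<^sub>m n"

definition dephased :: "nat \<Rightarrow> complex mat \<Rightarrow> bool" where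
  "dephased n H \<longleftrightarrow> (\<forall>j<n. H $$ (0, j) = 1) \<and> (\<forall>i<n. H $$ (i, 0) = 1)"

text \<open>The exponential series, summed entrywise; see \<open>summable_mat_exp\<close> for convergence.\<close>

definition mat_exp :: "complex mat \<Rightarrow> complex mat" where
  "mat_exp A = mat (dim_row A) (dim_col A) (\<lambda>(i, j). \<Sum>k. (A ^\<^sub>m k) $$ (i, j) / fact k)"

lemma norm_pow_mat_le:
  fixes A :: "complex mat"
  assumes A: "A \<in> carrier_mat n n" and c: "\<And>i j. i < n \<Longrightarrow> j < n \<Longrightarrow> norm (A $$ (i, j)) \<le> c"
    and i: "i < n" and j: "j < n"
  shows "norm ((A ^\<^sub>m k) $$ (i, j)) \<le> (real n * c) ^ k"
  using j
proof (induction k arbitrary: j)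
  case 0
  then show ?case using A i by auto
next
  case (Suc k)
  have c0: "0 \<le> c" using c[OF i i] norm_ge_zero order_trans by blast
  have P: "A ^\<^sub>m k \<in> carrier_mat n n" using A by simp
  have "(A ^\<^sub>m Suc k) $$ (i, j) = (\<Sum>l<n. (A ^\<^sub>m k) $$ (i, l) * A $$ (l, j))"
    using A P i Suc.prems by (auto simp: scalar_prod_def lessThan_atLeast0 intro!: sum.cong)
  also have "norm \<dots> \<le> (\<Sum>l<n. (real n * c) ^ k * c)"
    by (rule order_trans[OF norm_sum], rule sum_mono)
       (auto simp: norm_mult c0 intro!: mult_mono Suc.IH c Suc.prems)
  finally show ?case by (simp add: algebra_simps)
qed

lemma summable_mat_exp:
  fixes A :: "complex mat"
  assumes A: "A \<in> carrier_mat n n" and i: "i < n" and j: "j < n"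
  shows "summable (\<lambda>k. (A ^\<^sub>m k) $$ (i, j) / fact k)"
proof -
  define c where "c = (\<Sum>p\<in>{..<n}\<times>{..<n}. norm (A $$ p))"
  have c: "norm (A $$ (r, s)) \<le> c" if "r < n" "s < n" for r s
    unfolding c_def by (rule member_le_sum) (use that in auto)
  show ?thesis
  proof (rule summable_comparison_test'[OF summable_exp[of "real n * c"]])
    fix k :: nat
    show "norm ((A ^\<^sub>m k) $$ (i, j) / fact k) \<le> inverse (fact k) * (real n * c) ^ k"
      using norm_pow_mat_le[OF A c i j, of k]
      by (simp add: norm_divide field_simps)
  qed
qed

definition laplacian_fractional_revival ::
    "nat \<Rightarrow> (nat \<Rightarrow> nat \<Rightarrow> real) \<Rightarrow> complex \<Rightarrow> complex \<Rightarrow> nat \<Rightarrow> nat \<Rightarrow> real \<Rightarrow> bool" where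
  "laplacian_fractional_revival n w \<alpha> \<beta> a b \<tau> \<longleftrightarrow>
     mat_exp ((- \<i> * of_real \<tau>) \<cdot>\<^sub>m laplacian_mat n w) *\<^sub>v unit_vec n a =
       \<alpha> \<cdot>\<^sub>v unit_vec n a + \<beta> \<cdot>\<^sub>v unit_vec n b"

end

theory Submission
  imports Defs
begin

text \<open>Since \<open>L = P \<Lambda> P\<inverse>\<close> with \<open>P = H\<close>, the equation \<open>exp (-i\<tau>L) e\<^sub>a = \<alpha> e\<^sub>a + \<beta> e\<^sub>b\<close>
  can be read off in the coordinates \<open>P\<inverse>\<close>: it says
  \<open>\<theta>\<^sub>j cnj H\<^sub>a\<^sub>j = \<alpha> cnj H\<^sub>a\<^sub>j + \<beta> cnj H\<^sub>b\<^sub>j\<close> for all \<open>j\<close>, where \<open>\<theta>\<^sub>j = exp (-i\<tau>\<lambda>\<^sub>j)\<close>.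
  As \<open>L\<close> is symmetric, it is also diagonalised by the entrywise conjugate of \<open>H\<close>, so the same
  equations hold without the conjugations. Hence \<open>r = H\<^sub>b\<^sub>j / H\<^sub>a\<^sub>j\<close> satisfies
  \<open>\<alpha> + \<beta> r = \<theta>\<^sub>j = \<alpha> + \<beta> cnj r\<close>; it is real of modulus 1, so \<open>r = \<plusminus>1\<close> and \<open>\<theta>\<^sub>j = \<alpha> \<plusminus> \<beta>\<close>.
  The column \<open>j = 0\<close> of \<open>H\<close> is constant and lies in the kernel of \<open>L\<close>, which forces
  \<open>\<alpha> + \<beta> = 1\<close>. The parallelogram law then gives \<open>|\<alpha> - \<beta>| = 1\<close>, and \<open>\<gamma>\<close> is half its argument.\<close>

section \<open>Exponentials of diagonalised matrices\<close>

lemma pow_mat_diag: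
  fixes d :: "nat \<Rightarrow> 'a::comm_semiring_1"
  shows "mat_diag n d ^\<^sub>m k = mat_diag n (\<lambda>i. d i ^ k)"
proof (induction k)
  case 0
  have "dim_row (mat_diag n d) = n"
    by (simp add: mat_diag_def)
  then show ?case by simp
next
  case (Suc k)
  then show ?case by (simp add: mult.commute)
qed

lemma smult_mat_diag:
  fixes d :: "nat \<Rightarrow> 'a::semiring_0"
  shows "c \<cdot>\<^sub>m mat_diag n d = mat_diag n (\<lambda>i. c * d i)"
  by (rule eq_matI) (auto simp: mat_diag_def)

lemma index_mult_mat_diag_mult:
  fixes P Q :: "'a::semiring_0 mat"
  assumes "P \<in> carrier_mat n n" "Q \<in> carrier_mat n n" "i < n" "j < n"
  shows "(P * mat_diag n d * Q) $$ (i, j) = (\<Sum>l<n. P $$ (i, l) * d l * Q $$ (l, j))"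
  using assms by (simp add: mat_diag_mult_right scalar_prod_def lessThan_atLeast0)

text \<open>Conjugation commutes with powers, so each entry of \<open>A ^\<^sub>m k\<close> is a
  finite combination of the \<open>d l ^ k\<close>. Summing over \<open>k\<close> inside this finite
  sum leaves scalar exponential series.\<close>

lemma mat_exp_similar_diag:
  assumes A: "A \<in> carrier_mat n n" and wit: "similar_mat_wit A (mat_diag n d) P Q"
  shows "mat_exp A = P * mat_diag n (\<lambda>i. exp (d i)) * Q"
proof -
  note w = similar_mat_witD2[OF A wit]
  show ?thesis
  proof (rule eq_matI)
    fix i j
    assume "i < dim_row (P * mat_diag n (\<lambda>i. exp (d i)) * Q)"
      "j < dim_col (P * mat_diag n (\<lambda>i. exp (d i)) * Q)"
    then have ij: "i < n" "j < n"
      using w by auto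
    have entry: "(A ^\<^sub>m k) $$ (i, j) / fact k =
        (\<Sum>l<n. P $$ (i, l) * (d l ^ k /\<^sub>R fact k) * Q $$ (l, j))" for k
      unfolding similar_mat_wit_pow_id[OF wit] pow_mat_diag
        index_mult_mat_diag_mult[OF w(6,7) ij]
      by (simp add: sum_divide_distrib scaleR_conv_of_real divide_inverse sum_distrib_left mult_ac)
    have "(\<lambda>k. (A ^\<^sub>m k) $$ (i, j) / fact k) sums
        (\<Sum>l<n. P $$ (i, l) * exp (d l) * Q $$ (l, j))"
      unfolding entry by (intro sums_sum sums_mult sums_mult2 exp_converges)
    then show "mat_exp A $$ (i, j) = (P * mat_diag n (\<lambda>i. exp (d i)) * Q) $$ (i, j)"
      unfolding index_mult_mat_diag_mult[OF w(6,7) ij]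
      using A ij by (simp add: mat_exp_def sums_iff)
  qed (use A w in \<open>auto simp: mat_exp_def\<close>)
qed

text \<open>Multiplication by the invertible \<open>Q\<close> loses no information, and in the new
  coordinates the exponential acts on each coordinate separately.\<close>

lemma mat_exp_mult_vec_eq_iff:
  assumes A: "A \<in> carrier_mat n n" and wit: "similar_mat_wit A (mat_diag n d) P Q"
    and u: "u \<in> carrier_vec n" and v: "v \<in> carrier_vec n"
  shows "mat_exp A *\<^sub>v u = v \<longleftrightarrow>
    (\<forall>j<n. exp (d j) * (Q *\<^sub>v u) $ j = (Q *\<^sub>v v) $ j)"
proof -
  note w = similar_mat_witD2[OF A wit]
  define E where "E = mat_diag n (\<lambda>i. exp (d i))"
  have E: "E \<in> carrier_mat n n"
    by (simp add: E_def)
  have Eq: "mat_exp A *\<^sub>v u = P *\<^sub>v (E *\<^sub>v (Q *\<^sub>v u))"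
    unfolding mat_exp_similar_diag[OF A wit] E_def[symmetric] using w u E
    by (simp add: assoc_mult_mat_vec[of _ n n _ n])
  have "mat_exp A *\<^sub>v u = v \<longleftrightarrow> E *\<^sub>v (Q *\<^sub>v u) = Q *\<^sub>v v"
  proof
    assume "mat_exp A *\<^sub>v u = v"
    then have "Q *\<^sub>v v = Q *\<^sub>v (P *\<^sub>v (E *\<^sub>v (Q *\<^sub>v u)))"
      by (simp add: Eq)
    also have "\<dots> = (Q * P) *\<^sub>v (E *\<^sub>v (Q *\<^sub>v u))"
      by (rule assoc_mult_mat_vec[symmetric]) (use w u E in auto)
    finally show "E *\<^sub>v (Q *\<^sub>v u) = Q *\<^sub>v v"
      using w u E by simp
  next
    assume "E *\<^sub>v (Q *\<^sub>v u) = Q *\<^sub>v v"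
    then have "mat_exp A *\<^sub>v u = P *\<^sub>v (Q *\<^sub>v v)"
      by (simp add: Eq)
    also have "\<dots> = (P * Q) *\<^sub>v v"
      by (rule assoc_mult_mat_vec[symmetric]) (use w v in auto)
    finally show "mat_exp A *\<^sub>v u = v"
      using w v by simp
  qed
  also have "\<dots> \<longleftrightarrow> (\<forall>j<n. (E *\<^sub>v (Q *\<^sub>v u)) $ j = (Q *\<^sub>v v) $ j)"
    using w E by (auto simp: vec_eq_iff)
  also have "\<dots> \<longleftrightarrow> (\<forall>j<n. exp (d j) * (Q *\<^sub>v u) $ j = (Q *\<^sub>v v) $ j)"
  proof -
    have "(E *\<^sub>v x) $ j = exp (d j) * x $ j" if "j < n" "x \<in> carrier_vec n" for x j
    proof -
      have "(E *\<^sub>v x) $ j = (\<Sum>i\<in>{0..<n}. if j = i then exp (d i) * x $ i else 0)"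
        using that by (simp add: E_def mat_diag_def scalar_prod_def if_distrib[of "\<lambda>y. y * _"] cong: if_cong)
      then show ?thesis using that by simp
    qed
    moreover have "Q *\<^sub>v u \<in> carrier_vec n"
      using w u by simp
    ultimately show ?thesis by auto
  qed
  finally show ?thesis .
qed

text \<open>Transposition reverses \<open>P * B * Q\<close>. For symmetric \<open>A\<close> and
  diagonal \<open>B\<close> this yields a second diagonalisation of \<open>A\<close>, whose
  coordinate change is \<open>P\<^sup>T\<close> in place of \<open>Q\<close>.\<close>

lemma similar_mat_wit_transpose:
  fixes A :: "'a::comm_ring_1 mat"
  assumes "similar_mat_wit A B P Q"
  shows "similar_mat_wit A\<^sup>T B\<^sup>T Q\<^sup>T P\<^sup>T"
proof -
  define n where "n = dim_row A"
  note w = similar_mat_witD[OF n_def assms]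
  show ?thesis
  proof (rule similar_mat_witI)
    show "Q\<^sup>T * P\<^sup>T = 1\<^sub>m n" "P\<^sup>T * Q\<^sup>T = 1\<^sub>m n"
      using w by (metis transpose_mult transpose_one)+
    have "A\<^sup>T = Q\<^sup>T * (P * B)\<^sup>T"
      using w by (metis transpose_mult mult_carrier_mat)
    also have "\<dots> = Q\<^sup>T * (B\<^sup>T * P\<^sup>T)"
      using w by (metis transpose_mult)
    also have "\<dots> = Q\<^sup>T * B\<^sup>T * P\<^sup>T"
      using w by (simp add: assoc_mult_mat[of _ n n _ n _ n])
    finally show "A\<^sup>T = Q\<^sup>T * B\<^sup>T * P\<^sup>T" .
  qed (use w in auto)
qed

section \<open>Adjoints, Laplacians and Hadamard diagonalisation\<close>

lemma index_mat_adjoint: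
  fixes A :: "complex mat"
  assumes "A \<in> carrier_mat n m" "i < m" "j < n"
  shows "mat_adjoint A $$ (i, j) = cnj (A $$ (j, i))"
  using assms by (auto simp: mat_adjoint_def mat_of_rows_def)

lemma mat_adjoint_carrier:
  assumes "A \<in> carrier_mat n m"
  shows "mat_adjoint A \<in> carrier_mat m n"
  using assms by (auto simp: mat_adjoint_def)

lemma laplacian_mat_carrier: "laplacian_mat n w \<in> carrier_mat n n"
  unfolding laplacian_mat_def by (rule minus_carrier_mat) (simp add: adjacency_mat_def)

lemma index_laplacian_mat:
  assumes "i < n" "j < n"
  shows "laplacian_mat n w $$ (i, j) =
    (if i = j then \<Sum>l<n. of_real (w i l) else 0) - of_real (w i j)"
  using assms by (auto simp: laplacian_mat_def degree_mat_def adjacency_mat_def mat_diag_def)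

lemma laplacian_mat_transpose:
  assumes "weighted_graph n w"
  shows "(laplacian_mat n w)\<^sup>T = laplacian_mat n w"
  using assms laplacian_mat_carrier[of n w]
  by (intro eq_matI) (auto simp: index_laplacian_mat weighted_graph_def)

lemma laplacian_mat_row_sum:
  assumes "i < n"
  shows "(\<Sum>j<n. laplacian_mat n w $$ (i, j)) = 0"
proof -
  have "(\<Sum>j<n. laplacian_mat n w $$ (i, j)) =
      (\<Sum>j<n. if j = i then \<Sum>l<n. of_real (w i l) else 0) - (\<Sum>j<n. of_real (w i j))"
    unfolding sum_subtractf[symmetric] using assms
    by (intro sum.cong) (auto simp: index_laplacian_mat)
  then show ?thesis using assms by simp
qed

lemma hadamard_similar_mat_wit:
  assumes H: "complex_hadamard n H" and n: "n > 0" and A: "A \<in> carrier_mat n n"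
    and diag: "A = (1 / of_nat n) \<cdot>\<^sub>m (H * D * mat_adjoint H)" and D: "D \<in> carrier_mat n n"
  shows "similar_mat_wit A D H ((1 / of_nat n) \<cdot>\<^sub>m mat_adjoint H)"
proof -
  have Hc: "H \<in> carrier_mat n n" and HH: "H * mat_adjoint H = of_nat n \<cdot>\<^sub>m 1\<^sub>m n"
    using H by (auto simp: complex_hadamard_def)
  note Ac = mat_adjoint_carrier[OF Hc]
  have "H * ((1 / of_nat n) \<cdot>\<^sub>m mat_adjoint H) = (1 / of_nat n) \<cdot>\<^sub>m (H * mat_adjoint H)"
    using Hc Ac by (rule mult_smult_distrib)
  also have "\<dots> = 1\<^sub>m n"
    unfolding HH using n by (intro eq_matI) auto
  finally have 1: "H * ((1 / of_nat n) \<cdot>\<^sub>m mat_adjoint H) = 1\<^sub>m n" .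
  show ?thesis
  proof (rule similar_mat_witI[OF 1])
    \<comment> \<open>For square matrices a right inverse is also a left inverse.\<close>
    show "(1 / of_nat n) \<cdot>\<^sub>m mat_adjoint H * H = 1\<^sub>m n"
      by (rule mat_mult_left_right_inverse[OF Hc _ 1]) (use Ac in simp)
    show "A = H * D * ((1 / of_nat n) \<cdot>\<^sub>m mat_adjoint H)"
      unfolding diag by (rule mult_smult_distrib[symmetric]) (use Hc D Ac in auto)
  qed (use A Hc D Ac in auto)
qed

section \<open>Revival in eigenvector coordinates\<close>

lemma mult_unit_vec_comb_index:
  fixes Q :: "'a::comm_semiring_1 mat"
  assumes "Q \<in> carrier_mat n n" "j < n" "a < n" "b < n"
  shows "(Q *\<^sub>v unit_vec n a) $ j = Q $$ (j, a)"
    and "(Q *\<^sub>v (\<alpha> \<cdot>\<^sub>v unit_vec n a + \<beta> \<cdot>\<^sub>v unit_vec n b)) $ j =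
      \<alpha> * Q $$ (j, a) + \<beta> * Q $$ (j, b)"
proof -
  show "(Q *\<^sub>v unit_vec n a) $ j = Q $$ (j, a)"
    using assms by simp
  show "(Q *\<^sub>v (\<alpha> \<cdot>\<^sub>v unit_vec n a + \<beta> \<cdot>\<^sub>v unit_vec n b)) $ j =
      \<alpha> * Q $$ (j, a) + \<beta> * Q $$ (j, b)"
    using assms by (simp add: scalar_prod_add_distrib[of _ n])
qed

text \<open>The witness stays arbitrary so that the criterion applies both to the Hadamard
  diagonalisation and to its transpose.\<close>

lemma laplacian_fractional_revival_iff_wit:
  assumes wit: "similar_mat_wit (laplacian_mat n w) (mat_diag n ev) P Q"
    and ab: "a < n" "b < n"
  shows "laplacian_fractional_revival n w \<alpha> \<beta> a b \<tau> \<longleftrightarrow>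
    (\<forall>j<n. exp (- \<i> * of_real \<tau> * ev j) * Q $$ (j, a) = \<alpha> * Q $$ (j, a) + \<beta> * Q $$ (j, b))"
proof -
  let ?c = "- \<i> * of_real \<tau> :: complex"
  have Q: "Q \<in> carrier_mat n n"
    using similar_mat_witD2[OF laplacian_mat_carrier wit] by simp
  have "similar_mat_wit (?c \<cdot>\<^sub>m laplacian_mat n w) (mat_diag n (\<lambda>j. ?c * ev j)) P Q"
    using similar_mat_wit_smult[OF wit] by (simp only: smult_mat_diag)
  from mat_exp_mult_vec_eq_iff[OF smult_carrier_mat[OF laplacian_mat_carrier] this,
      of "unit_vec n a" "\<alpha> \<cdot>\<^sub>v unit_vec n a + \<beta> \<cdot>\<^sub>v unit_vec n b"]
  show ?thesis
    unfolding laplacian_fractional_revival_def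
    using mult_unit_vec_comb_index[OF Q _ ab] by simp
qed

section \<open>Scalar computations\<close>

lemma unimodular_ratio_real:
  assumes "norm x = 1" "norm y = 1" "\<beta> \<noteq> 0"
    and 1: "\<theta> * x = \<alpha> * x + \<beta> * y" and 2: "\<theta> * cnj x = \<alpha> * cnj x + \<beta> * cnj y"
  shows "x = y \<or> x = - y"
proof -
  have x: "x * cnj x = 1" and y: "y * cnj y = 1"
    using assms by (simp_all add: complex_norm_square[symmetric])
  \<comment> \<open>The product \<open>x * cnj x\<close> is left unevaluated so that this right-hand
    side and the next one are literally the same.\<close>
  have "\<beta> * (y * cnj x) = (\<theta> - \<alpha>) * (x * cnj x)"
    using arg_cong[OF 1, of "\<lambda>z. z * cnj x"] by (simp add: algebra_simps)
  moreover have "\<beta> * (x * cnj y) = (\<theta> - \<alpha>) * (x * cnj x)"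
    using arg_cong[OF 2, of "\<lambda>z. z * x"] by (simp add: algebra_simps)
  ultimately have "\<beta> * (y * cnj x) = \<beta> * (x * cnj y)"
    by (simp only:)
  then have r: "y * cnj x = x * cnj y"
    using \<open>\<beta> \<noteq> 0\<close> by simp
  \<comment> \<open>By \<open>r\<close> the number \<open>y * cnj x\<close> equals its conjugate;
    exchanging the two turns \<open>x\<^sup>2\<close> into \<open>y\<^sup>2\<close>.\<close>
  have "x\<^sup>2 = x\<^sup>2 * (y * cnj y)"
    by (simp add: y)
  also have "\<dots> = x * y * (x * cnj y)"
    by (simp add: power2_eq_square)
  also have "\<dots> = x * y * (y * cnj x)"
    by (simp add: r)
  also have "\<dots> = y\<^sup>2 * (x * cnj x)"
    by (simp add: power2_eq_square)
  finally show ?thesis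
    by (simp add: x power2_eq_iff)
qed

lemma revival_scalars_param:
  assumes sum: "\<alpha> + \<beta> = 1" and norms: "(norm \<alpha>)\<^sup>2 + (norm \<beta>)\<^sup>2 = 1"
  obtains \<gamma> :: real where "\<alpha> = of_real (cos \<gamma>) * exp (\<i> * of_real \<gamma>)"
    and "\<beta> = - \<i> * of_real (sin \<gamma>) * exp (\<i> * of_real \<gamma>)"
    and "\<alpha> - \<beta> = exp (2 * of_real \<gamma> * \<i>)"
proof
  have "(norm (\<alpha> + \<beta>))\<^sup>2 + (norm (\<alpha> - \<beta>))\<^sup>2 = 2 * ((norm \<alpha>)\<^sup>2 + (norm \<beta>)\<^sup>2)"
    by (simp add: cmod_power2) (simp add: power2_eq_square algebra_simps)
  \<comment> \<open>The first summand is 1 and the right-hand side is 2; nonnegativity of the norm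
    rules out the root -1.\<close>
  then have "norm (\<alpha> - \<beta>) = 1"
    using sum norms by (simp add: power2_eq_1_iff) (smt (verit) norm_ge_zero)
  define \<gamma> where "\<gamma> = Arg (\<alpha> - \<beta>) / 2"
  have "\<alpha> - \<beta> = cis (2 * \<gamma>)"
    using \<open>norm (\<alpha> - \<beta>) = 1\<close> rcis_cmod_Arg[of "\<alpha> - \<beta>"] by (simp add: \<gamma>_def rcis_def)
  also have "\<dots> = exp (2 * of_real \<gamma> * \<i>)"
    by (simp add: cis_conv_exp mult.commute)
  finally show d: "\<alpha> - \<beta> = exp (2 * of_real \<gamma> * \<i>)" .
  have e: "exp (2 * of_real \<gamma> * \<i>) = cis \<gamma> * cis \<gamma>"
    by (simp add: cis_conv_exp exp_add[symmetric] algebra_simps)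
  \<comment> \<open>Half-angle trick: pulling \<open>cis \<gamma>\<close> out of
    \<open>1 + cis (2 * \<gamma>)\<close> and \<open>1 - cis (2 * \<gamma>)\<close> leaves twice a
    cosine and a multiple of a sine.\<close>
  have "2 * \<alpha> = 1 + (\<alpha> - \<beta>)" "2 * \<beta> = 1 - (\<alpha> - \<beta>)"
    unfolding sum[symmetric] by simp_all
  then have a: "2 * \<alpha> = cis \<gamma> * (cis (- \<gamma>) + cis \<gamma>)"
    and b: "2 * \<beta> = cis \<gamma> * (cis (- \<gamma>) - cis \<gamma>)"
    unfolding d e by (simp_all add: algebra_simps cis_mult)
  have c: "cis (- \<gamma>) + cis \<gamma> = 2 * of_real (cos \<gamma>)"
    and s: "cis (- \<gamma>) - cis \<gamma> = 2 * (- \<i> * of_real (sin \<gamma>))"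
    by (simp_all add: complex_eq_iff)
  show "\<alpha> = of_real (cos \<gamma>) * exp (\<i> * of_real \<gamma>)"
    using a unfolding c cis_conv_exp[symmetric] by simp
  show "\<beta> = - \<i> * of_real (sin \<gamma>) * exp (\<i> * of_real \<gamma>)"
    using b unfolding s cis_conv_exp[symmetric] by simp
qed

text \<open>The column conditions involve \<alpha> and \<beta> only through their difference, so
  they cannot determine the sum; hence \<open>\<alpha> + \<beta> = 1\<close> is a separate conjunct
  of the criterion.\<close>

theorem theorem4p1:
  fixes n a b :: nat and w :: "nat \<Rightarrow> nat \<Rightarrow> real" and H :: "complex mat"
    and ev :: "nat \<Rightarrow> complex" and \<alpha> \<beta> :: complex and \<tau> :: real
  assumes graph: "weighted_graph n w"
    and hadamard: "complex_hadamard n H" and deph: "dephased n H"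
    and diag: "laplacian_mat n w = (1 / of_nat n) \<cdot>\<^sub>m (H * mat_diag n ev * mat_adjoint H)"
    and vertices: "a < n" "b < n"
    and scalars: "\<beta> \<noteq> 0" "(norm \<alpha>)\<^sup>2 + (norm \<beta>)\<^sup>2 = 1"
  shows "(laplacian_fractional_revival n w \<alpha> \<beta> a b \<tau> \<longleftrightarrow>
           \<alpha> + \<beta> = 1 \<and>
           (\<forall>j<n. (H $$ (a, j) = H $$ (b, j) \<or> H $$ (a, j) = - H $$ (b, j)) \<and>
              (H $$ (a, j) = H $$ (b, j) \<longrightarrow> exp (- \<i> * of_real \<tau> * ev j) = 1) \<and>
              (H $$ (a, j) = - H $$ (b, j) \<longrightarrow> exp (- \<i> * of_real \<tau> * ev j) = \<alpha> - \<beta>)))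
       \<and> (laplacian_fractional_revival n w \<alpha> \<beta> a b \<tau> \<longrightarrow>
           (\<exists>\<gamma>::real. \<alpha> = of_real (cos \<gamma>) * exp (\<i> * of_real \<gamma>) \<and>
                     \<beta> = - \<i> * of_real (sin \<gamma>) * exp (\<i> * of_real \<gamma>) \<and>
                     \<alpha> - \<beta> = exp (2 * of_real \<gamma> * \<i>)))"
proof -
  have n: "n > 0"
    using vertices by simp
  define Q where "Q = (1 / of_nat n) \<cdot>\<^sub>m mat_adjoint H"
  define \<theta> where "\<theta> j = exp (- \<i> * of_real \<tau> * ev j)" for j
  have H: "H \<in> carrier_mat n n" and unimod: "\<And>i j. i < n \<Longrightarrow> j < n \<Longrightarrow> norm (H $$ (i, j)) = 1"
    using hadamard by (auto simp: complex_hadamard_def)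
  have Q_index: "Q $$ (j, i) = cnj (H $$ (i, j)) / of_nat n" if "i < n" "j < n" for i j
    using that H mat_adjoint_carrier[OF H] by (simp add: Q_def index_mat_adjoint)
  have wit: "similar_mat_wit (laplacian_mat n w) (mat_diag n ev) H Q"
    unfolding Q_def
    by (rule hadamard_similar_mat_wit[OF hadamard n laplacian_mat_carrier diag mat_diag_dim])
  have "(mat_diag n ev)\<^sup>T = mat_diag n ev"
    by (rule eq_matI) (auto simp: mat_diag_def)
  then have wit': "similar_mat_wit (laplacian_mat n w) (mat_diag n ev) Q\<^sup>T H\<^sup>T"
    using similar_mat_wit_transpose[OF wit] by (simp add: laplacian_mat_transpose[OF graph])

  \<comment> \<open>The transposed witness has coordinate change \<open>H\<^sup>T\<close>, whose
    entries carry no conjugation.\<close>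
  have rev: "laplacian_fractional_revival n w \<alpha> \<beta> a b \<tau> \<longleftrightarrow>
      (\<forall>j<n. \<theta> j * H $$ (a, j) = \<alpha> * H $$ (a, j) + \<beta> * H $$ (b, j))"
    using laplacian_fractional_revival_iff_wit[OF wit' vertices] H vertices
    by (simp add: \<theta>_def)
  have rev_cnj: "laplacian_fractional_revival n w \<alpha> \<beta> a b \<tau> \<longleftrightarrow>
      (\<forall>j<n. \<theta> j * cnj (H $$ (a, j)) = \<alpha> * cnj (H $$ (a, j)) + \<beta> * cnj (H $$ (b, j)))"
  proof -
    \<comment> \<open>The common factor 1/n in the entries of \<open>Q\<close> cancels.\<close>
    have "\<theta> j * Q $$ (j, a) = \<alpha> * Q $$ (j, a) + \<beta> * Q $$ (j, b) \<longleftrightarrow>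
        \<theta> j * cnj (H $$ (a, j)) = \<alpha> * cnj (H $$ (a, j)) + \<beta> * cnj (H $$ (b, j))"
      if "j < n" for j
      using that vertices n by (simp add: Q_index add_divide_distrib[symmetric])
    then show ?thesis
      unfolding laplacian_fractional_revival_iff_wit[OF wit vertices] \<theta>_def by blast
  qed

  have "ev 0 = 0"
  proof -
    let ?L = "laplacian_mat n w"
    note w = similar_mat_witD2[OF laplacian_mat_carrier wit]
    \<comment> \<open>The (0, 0) entries of \<open>?L * H = H * mat_diag n ev\<close> are compared:
      since column 0 and row 0 of \<open>H\<close> are all ones, the left one is a row sum of the
      Laplacian and the right one is \<open>ev 0\<close>.\<close>
    have "?L * H = H * mat_diag n ev * (Q * H)"
      unfolding w(3) by (rule assoc_mult_mat[of _ n n _ n]) (use w in auto)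
    then have LH: "?L * H = H * mat_diag n ev"
      using w by simp
    have "ev 0 = (H * mat_diag n ev) $$ (0, 0)"
      using H n deph by (simp add: mat_diag_mult_right dephased_def)
    also have "\<dots> = (\<Sum>j<n. ?L $$ (0, j))"
      unfolding LH[symmetric] using laplacian_mat_carrier[of n w] H n deph
      by (simp add: scalar_prod_def dephased_def lessThan_atLeast0)
    finally show ?thesis
      using laplacian_mat_row_sum[OF n] by simp
  qed
  then have "\<theta> 0 = 1"
    by (simp add: \<theta>_def)

  \<comment> \<open>At \<open>j = 0\<close> both entries of \<open>H\<close> are 1, so the equation
    in \<open>rev\<close> reads \<open>\<theta> 0 = \<alpha> + \<beta>\<close>.\<close>
  have sum: "\<alpha> + \<beta> = 1" if "laplacian_fractional_revival n w \<alpha> \<beta> a b \<tau>"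
    using that rev n \<open>\<theta> 0 = 1\<close> deph vertices by (auto simp: dephased_def)
  have nz: "H $$ (b, j) \<noteq> 0" if "j < n" for j
    using unimod[OF vertices(2) that] by auto
  have "laplacian_fractional_revival n w \<alpha> \<beta> a b \<tau> \<longleftrightarrow> \<alpha> + \<beta> = 1 \<and>
      (\<forall>j<n. (H $$ (a, j) = H $$ (b, j) \<or> H $$ (a, j) = - H $$ (b, j)) \<and>
        (H $$ (a, j) = H $$ (b, j) \<longrightarrow> \<theta> j = 1) \<and>
        (H $$ (a, j) = - H $$ (b, j) \<longrightarrow> \<theta> j = \<alpha> - \<beta>))"
    (is "?R \<longleftrightarrow> ?C")
  proof
    assume R: ?R
    show ?C
    proof (intro conjI allI impI)
      show "\<alpha> + \<beta> = 1"
        using sum[OF R] .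
      fix j assume j: "j < n"
      have e: "\<theta> j * H $$ (a, j) = \<alpha> * H $$ (a, j) + \<beta> * H $$ (b, j)"
        using R rev j by blast
      \<comment> \<open>Here both forms of the equation are combined; the other two claims follow
        from \<open>e\<close> by cancelling \<open>H $$ (b, j)\<close>.\<close>
      show "H $$ (a, j) = H $$ (b, j) \<or> H $$ (a, j) = - H $$ (b, j)"
        using unimodular_ratio_real[OF _ _ scalars(1) e] R rev_cnj j unimod vertices by blast
      show "\<theta> j = 1" if "H $$ (a, j) = H $$ (b, j)"
        using e nz[OF j] sum[OF R] that by (simp flip: distrib_right)
      show "\<theta> j = \<alpha> - \<beta>" if "H $$ (a, j) = - H $$ (b, j)"
      proof -
        have "\<theta> j * H $$ (b, j) = (\<alpha> - \<beta>) * H $$ (b, j)"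
          using e that by (simp add: algebra_simps)
        then show ?thesis using nz[OF j] by simp
      qed
    qed
  next
    assume C: ?C
    show ?R
      unfolding rev
    proof (intro allI impI)
      fix j assume "j < n"
      \<comment> \<open>The value 1 is rewritten as \<open>\<alpha> + \<beta>\<close>, after which
        both cases are linear identities.\<close>
      then consider "H $$ (a, j) = H $$ (b, j)" "\<theta> j = \<alpha> + \<beta>"
        | "H $$ (a, j) = - H $$ (b, j)" "\<theta> j = \<alpha> - \<beta>"
        using C by auto
      then show "\<theta> j * H $$ (a, j) = \<alpha> * H $$ (a, j) + \<beta> * H $$ (b, j)"
        by cases (simp_all add: distrib_right left_diff_distrib)
    qed
  qed
  then show ?thesis
    using revival_scalars_param[OF _ scalars(2)] sum unfolding \<theta>_def by metis
qed

end
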